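(* Let $f\in L^1(\mathcal F_\infty)$ and $\lambda>0$. Then one can write $$f=g+h+k$$ with $g,h,k\in L^1(\mathcal F_\infty)$ such that: (a$'$) $$\mathbb P\Bigl(\sup_{n\ge1}|\mathbb E_n[g]|>0\Bigr)\le \frac{2\|f\|_1}{\lambda},\qquad \|g\|_1\le 4\|f\|_1;$$ (b$'$) $$\Bigl\|\sum_{n=1}^{\infty}\bigl|\mathbb E_n[h]-\mathbb E_{n-1}[h]\bigr|\Bigr\|_1\le 4\|f\|_1,$$ and in particular $\|h\|_1\le 4\|f\|_1$; (c$'$) $$\|k\|_\infty\le\lambda,\qquad \|k\|_1\le 2\|f\|_1,\qquad \|k\|_2^2\le 2\lambda\|f\|_1.$$
   Context: $(\Omega,\mathcal F,\mathbb P)$ is a complete probability space with a discrete filtration $(\mathcal F_n)_{n\ge1}$, and $\mathcal F_\infty:=\sigma\bigl(\bigcup_{n\ge1}\mathcal F_n\bigr)$. For a sub-$\sigma$-field $\mathcal F'\subseteq\mathcal F$, $L^p(\mathcal F')$ is the subspace of $L^p(\Omega,\mathbb P)$ consisting of $\mathcal F'$-measurable (real-valued) functions. $\mathbb E_n:=\mathbb E[\,\cdot\mid\mathcal F_n]$ for $n\ge1$, and $\mathbb E_0\equiv 0$ (the zero operator). $\|\cdot\|_p$ is the norm of $L^p(\Omega,\mathbb P)$. *)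

theory Defs
  imports "HOL-Probability.Probability"
begin

text \<open>
  Elements of \<open>L\<^sup>p\<close> are represented by real-valued functions. Norms take values in
  \<^typ>\<open>ennreal\<close>, so that they are infinite, and not a default value, outside \<open>L\<^sup>p\<close>.
\<close>

definition Lp_norm :: "'a measure \<Rightarrow> real \<Rightarrow> ('a \<Rightarrow> real) \<Rightarrow> ennreal" where
  "Lp_norm M p f =
    (let I = (\<integral>\<^sup>+ x. ennreal (\<bar>f x\<bar> powr p) \<partial>M)
     in if I = \<infinity> then \<infinity> else ennreal (enn2real I powr (1 / p)))"

definition Linf_norm :: "'a measure \<Rightarrow> ('a \<Rightarrow> real) \<Rightarrow> ennreal" where
  "Linf_norm M f = esssup M (\<lambda>x. ennreal \<bar>f x\<bar>)"

text \<open>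
  \<open>G\<close> is used only through its sets (a sub-\<open>\<sigma>\<close>-algebra of \<open>M\<close>); the measure is that of \<open>M\<close>.
\<close>

definition Lp_space :: "'a measure \<Rightarrow> 'a measure \<Rightarrow> real \<Rightarrow> ('a \<Rightarrow> real) set" where
  "Lp_space M G p = {f \<in> borel_measurable G. Lp_norm M p f < \<infinity>}"

text \<open>Filtrations are indexed by \<open>n \<ge> 1\<close>; the value \<open>F 0\<close> is never used.\<close>

definition is_filtration :: "'a measure \<Rightarrow> (nat \<Rightarrow> 'a measure) \<Rightarrow> bool" where
  "is_filtration M F \<longleftrightarrow>
    (\<forall>n\<ge>1. subalgebra M (F n)) \<and> filtration (space M) (\<lambda>n. F (Suc n))"

definition F_infinity :: "'a measure \<Rightarrow> (nat \<Rightarrow> 'a measure) \<Rightarrow> 'a measure" where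
  "F_infinity M F = sigma (space M) (\<Union>n\<in>{1..}. sets (F n))"

definition cexp :: "'a measure \<Rightarrow> (nat \<Rightarrow> 'a measure) \<Rightarrow> nat \<Rightarrow> ('a \<Rightarrow> real) \<Rightarrow> 'a \<Rightarrow> real" where
  "cexp M F n f = (if n = 0 then (\<lambda>_. 0) else real_cond_exp M (F n) f)"

end

theory Submission
  imports Defs
begin

text \<open>
  Splitting \<open>f\<close> into positive and negative parts, it is enough to decompose \<open>f \<ge> 0\<close> with
  \<open>0 \<le> k \<le> \<lambda>\<close>, since all bounds are additive. Let \<open>X\<^sub>n = E\<^sub>n[f]\<close> and \<open>c = \<lambda>/2\<close>. The
  supermartingale \<open>Y\<^sub>n = min(X\<^sub>n, c)\<close> has a Doob decomposition \<open>Y = m - a\<close> with \<open>a\<close> predictable,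
  increasing and of expectation at most \<open>\<parallel>f\<parallel>\<^sub>1\<close>. Stop at the first time \<open>\<sigma>\<close> with \<open>m\<^sub>\<sigma> \<ge> c\<close>, an event
  of probability at most \<open>\<parallel>f\<parallel>\<^sub>1/c\<close> since \<open>m\<close> is a nonnegative martingale. As
  \<open>a\<^sub>n\<^sub>+\<^sub>1 \<le> m\<^sub>n\<close>, the stopped martingale \<open>m\<close> stays below \<open>2c\<close>; it is the martingale of \<open>k\<close>.
  Before \<open>\<sigma>\<close> one has \<open>X = Y\<close>, so the increments of the stopped martingale \<open>X - m\<close> are those of \<open>-a\<close>,
  except for a jump of size at most \<open>X\<^sub>\<sigma>\<close> at \<open>\<sigma>\<close>: this is the martingale of \<open>h\<close>.
  The rest \<open>g = f - X\<^sub>\<sigma>\<close> lives on \<open>{\<sigma> < \<infinity>}\<close>.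
\<close>

section \<open>Measure-theoretic preliminaries\<close>

text \<open>Sets approximable to every precision are closed under complements, which leave the
  symmetric difference unchanged, and under countable unions: continuity from below reduces to a
  finite union, which is approximated term by term.\<close>

lemma (in finite_measure) algebra_approximation:
  assumes A: "algebra (space M) A" "A \<subseteq> sets M"
    and B: "B \<in> sigma_sets (space M) A" and e: "e > 0"
  shows "\<exists>B'\<in>A. measure M ((B - B') \<union> (B' - B)) < e"
  using B e
proof (induction arbitrary: e rule: sigma_sets.induct)
  case (Basic a)
  then show ?case by (auto intro!: bexI[of _ a])
next
  case Empty
  interpret algebra "space M" A by fact
  show ?case using Empty by (auto intro!: bexI[of _ "{}"])
next
  case (Compl B)
  interpret algebra "space M" A by fact
  obtain B' where B': "B' \<in> A" "measure M ((B - B') \<union> (B' - B)) < e"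
    using Compl by blast
  have "B \<subseteq> space M" using Compl(1) sigma_sets_into_sp[OF space_closed] by blast
  moreover have "B' \<subseteq> space M" using B'(1) space_closed by blast
  ultimately have "((space M - B) - (space M - B')) \<union> ((space M - B') - (space M - B)) = (B - B') \<union> (B' - B)"
    by blast
  then show ?case using B' by (auto intro!: bexI[of _ "space M - B'"])
next
  case (Union S)
  interpret algebra "space M" A by fact
  have SM: "S i \<in> sets M" for i
    using Union(1)[of i] A(2) sets.sigma_sets_subset by blast
  have "(\<lambda>n. measure M (\<Union>i<n. S i)) \<longlonglongrightarrow> measure M (\<Union>n. \<Union>i<n. S i)"
    using SM by (intro finite_Lim_measure_incseq) (auto simp: incseq_def, force)
  moreover have "(\<Union>n. \<Union>i<n. S i) = (\<Union>i. S i)" by auto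
  ultimately have "(\<lambda>n. measure M (\<Union>i<n. S i)) \<longlonglongrightarrow> measure M (\<Union>i. S i)" by simp
  then obtain n where n: "\<bar>measure M (\<Union>i<n. S i) - measure M (\<Union>i. S i)\<bar> < e/2"
    using Union(3) by (auto simp: LIMSEQ_iff dest!: spec[of _ "e/2"])
  \<comment> \<open>The \<open>n\<close> errors then add up to at most \<open>e / 2\<close>; the
    summand 1 keeps the denominator positive when \<open>n = 0\<close>.\<close>
  define e' where "e' = e / (2 * (real n + 1))"
  have "e' > 0" using Union(3) by (simp add: e'_def)
  then have "\<forall>i. \<exists>B'\<in>A. measure M ((S i - B') \<union> (B' - S i)) < e'" using Union(2) by blast
  then obtain T where T: "\<And>i. T i \<in> A" "\<And>i. measure M ((S i - T i) \<union> (T i - S i)) < e'"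
    by metis
  have TM: "T i \<in> sets M" for i using T A(2) by auto
  \<comment> \<open>\<open>?D\<close> is what the first \<open>n\<close> sets miss of the union,
    \<open>?E\<close> collects the errors of the \<open>T i\<close>; together they cover the
    symmetric difference.\<close>
  let ?D = "(\<Union>i. S i) - (\<Union>i<n. S i)" and ?E = "\<Union>i<n. (S i - T i) \<union> (T i - S i)"
  have "measure M (((\<Union>i. S i) - (\<Union>i<n. T i)) \<union> ((\<Union>i<n. T i) - (\<Union>i. S i))) \<le> measure M (?D \<union> ?E)"
    using SM TM by (intro finite_measure_mono) auto
  also have "\<dots> \<le> measure M ?D + measure M ?E"
    using SM TM by (intro measure_Un_le) auto
  also have "measure M ?D = measure M (\<Union>i. S i) - measure M (\<Union>i<n. S i)"
    using SM by (intro finite_measure_Diff) auto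
  also have "\<dots> < e/2" using n by linarith
  also have "measure M ?E \<le> (\<Sum>i<n. measure M ((S i - T i) \<union> (T i - S i)))"
    using SM TM by (intro measure_UNION_le) auto
  also have "\<dots> \<le> (\<Sum>i<n. e')" using T(2) by (intro sum_mono less_imp_le)
  also have "\<dots> \<le> e/2" using Union(3) by (simp add: e'_def field_simps)
  finally have "measure M (((\<Union>i. S i) - (\<Union>i<n. T i)) \<union> ((\<Union>i<n. T i) - (\<Union>i. S i))) < e" by simp
  moreover have "(\<Union>i<n. T i) \<in> A" using T by auto
  ultimately show ?case by blast
qed

text \<open>The set \<open>B\<close> where \<open>u\<close> is negative lies in the generated
  \<sigma>-algebra. Approximating it by members of the algebra transfers the sign condition to
  \<open>B\<close>, which forces the integral of \<open>u\<close> over \<open>B\<close> to be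
  0.\<close>

lemma (in finite_measure) AE_nonneg_if_integral_nonneg_on_algebra:
  fixes u :: "'a \<Rightarrow> real"
  assumes A: "algebra (space M) A" "A \<subseteq> sets M"
    and u: "integrable M u" "u \<in> borel_measurable (sigma (space M) A)"
    and pos: "\<And>B. B \<in> A \<Longrightarrow> 0 \<le> (\<integral>x\<in>B. u x \<partial>M)"
  shows "AE x in M. 0 \<le> u x"
proof -
  interpret algebra "space M" A by fact
  note [measurable] = borel_measurable_integrable[OF u(1)]
  \<comment> \<open>Approximation takes place in the measure with density |u|: its value on a
    symmetric difference directly bounds the change in the integral of \<open>u\<close>.\<close>
  define N where "N = density M (\<lambda>x. ennreal \<bar>u x\<bar>)"
  have iI: "integrable M (\<lambda>x. indicator B x * \<bar>u x\<bar>)" "integrable M (\<lambda>x. indicator B x * u x)"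
    if "B \<in> sets M" for B
    using integrable_mult_indicator[OF that u(1)]
      integrable_mult_indicator[OF that integrable_abs[OF u(1)]] by simp_all
  have N_eq: "emeasure N B = ennreal (\<integral>x. indicator B x * \<bar>u x\<bar> \<partial>M)" if [measurable]: "B \<in> sets M" for B
  proof -
    have "emeasure N B = (\<integral>\<^sup>+x. ennreal (indicator B x * \<bar>u x\<bar>) \<partial>M)"
      unfolding N_def by (subst emeasure_density)
        (auto intro!: nn_integral_cong split: split_indicator)
    then show ?thesis
      using iI(1)[OF that] by (simp add: nn_integral_eq_integral)
  qed
  have sN: "space N = space M" "sets N = sets M" by (simp_all add: N_def)
  interpret N: finite_measure N
    by (rule finite_measureI) (simp add: N_eq sN)
  have mN: "measure N B = (\<integral>x. indicator B x * \<bar>u x\<bar> \<partial>M)" if "B \<in> sets M" for B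
    by (simp add: measure_def N_eq[OF that] integral_nonneg_AE)
  define B where "B = {x \<in> space M. u x < 0}"
  have BA: "B \<in> sigma_sets (space M) A"
  proof -
    have "u -` {..<0} \<inter> space (sigma (space M) A) \<in> sets (sigma (space M) A)"
      using u(2) by (rule measurable_sets) auto
    moreover have "u -` {..<0} \<inter> space (sigma (space M) A) = B"
      by (auto simp: B_def space_measure_of[OF space_closed])
    ultimately show ?thesis by (simp add: sets_measure_of[OF space_closed])
  qed
  have BM[measurable]: "B \<in> sets M" by (simp add: B_def)
  have "- e \<le> (\<integral>x. indicator B x * u x \<partial>M)" if "e > 0" for e
  proof -
    have "\<exists>B'\<in>A. measure N ((B - B') \<union> (B' - B)) < e"
      by (rule N.algebra_approximation) (simp_all only: sN A BA that)
    then obtain B' where B': "B' \<in> A" "measure N ((B - B') \<union> (B' - B)) < e"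
      by blast
    have [measurable]: "B' \<in> sets M" using B'(1) A(2) by blast
    let ?D = "(B - B') \<union> (B' - B)"
    have "- e \<le> (\<integral>x. indicator B' x * u x \<partial>M) - (\<integral>x. indicator ?D x * \<bar>u x\<bar> \<partial>M)"
      using pos[OF B'(1)] B'(2) by (simp add: mN set_lebesgue_integral_def del: Un_iff)
    also have "\<dots> = (\<integral>x. indicator B' x * u x - indicator ?D x * \<bar>u x\<bar> \<partial>M)"
      by (intro Bochner_Integration.integral_diff[symmetric] iI) auto
    also have "\<dots> \<le> (\<integral>x. indicator B x * u x \<partial>M)"
    proof (intro integral_mono Bochner_Integration.integrable_diff iI)
      show "indicator B' x * u x - indicator ?D x * \<bar>u x\<bar> \<le> indicator B x * u x" for x
        by (cases "x \<in> B"; cases "x \<in> B'") auto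
    qed auto
    finally show ?thesis .
  qed
  then have "0 \<le> (\<integral>x. indicator B x * u x \<partial>M)"
    using dense_ge[of 0 "- (\<integral>x. indicator B x * u x \<partial>M)"] by (force simp: minus_le_iff)
  moreover have "(\<lambda>x. indicator B x * u x) = (\<lambda>x. - (indicator B x * \<bar>u x\<bar>))"
  proof
    show "indicator B x * u x = - (indicator B x * \<bar>u x\<bar>)" for x
      by (cases "x \<in> B") (simp_all add: B_def)
  qed
  ultimately have "(\<integral>x. indicator B x * \<bar>u x\<bar> \<partial>M) \<le> 0"
    by (simp only: Bochner_Integration.integral_minus neg_0_le_iff_le)
  moreover have "0 \<le> (\<integral>x. indicator B x * \<bar>u x\<bar> \<partial>M)"
    by (rule integral_nonneg_AE) simp
  ultimately have "(\<integral>x. indicator B x * \<bar>u x\<bar> \<partial>M) = 0"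
    by (rule antisym)
  then have "AE x in M. indicator B x * \<bar>u x\<bar> = 0"
    using integral_nonneg_eq_0_iff_AE[OF iI(1)[OF BM]] by simp
  then show ?thesis
    using AE_space
  proof eventually_elim
    fix x assume "indicator B x * \<bar>u x\<bar> = 0" "x \<in> space M"
    then show "0 \<le> u x" by (cases "x \<in> B") (simp_all add: B_def)
  qed
qed

section \<open>Series of integrable functions\<close>

lemma nn_integral_suminf_le_of_sum_integral_le:
  fixes w :: "nat \<Rightarrow> 'a \<Rightarrow> real"
  assumes w: "\<And>i. integrable M (w i)" "\<And>i. AE x in M. 0 \<le> w i x"
    and C: "\<And>n. (\<Sum>i<n. \<integral>x. w i x \<partial>M) \<le> C"
  shows "(\<integral>\<^sup>+ x. (\<Sum>i. ennreal (w i x)) \<partial>M) \<le> ennreal C"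
proof -
  note [measurable] = borel_measurable_integrable[OF w(1)]
  have "(\<integral>\<^sup>+ x. (\<Sum>i. ennreal (w i x)) \<partial>M) = (\<Sum>i. \<integral>\<^sup>+ x. ennreal (w i x) \<partial>M)"
    by (rule nn_integral_suminf) simp
  also have "\<dots> = (\<Sum>i. ennreal (\<integral>x. w i x \<partial>M))"
    using w by (simp add: nn_integral_eq_integral)
  also have "\<dots> \<le> ennreal C"
    using C w(2) by (intro suminf_le_const) (auto simp: sum_ennreal integral_nonneg_AE intro: ennreal_leI)
  finally show ?thesis .
qed

text \<open>By Tonelli, one finite integral yields summability almost everywhere and summability of
  the integrals, the two conditions for integrating term by term.\<close>

lemma
  fixes u :: "nat \<Rightarrow> 'a \<Rightarrow> real"
  assumes u: "\<And>i. integrable M (u i)"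
    and fin: "(\<integral>\<^sup>+ x. (\<Sum>i. ennreal \<bar>u i x\<bar>) \<partial>M) < \<infinity>"
  shows AE_summable_of_nn_integral: "AE x in M. summable (\<lambda>i. \<bar>u i x\<bar>)"
    and summable_integral_of_nn_integral: "summable (\<lambda>i. \<integral>x. \<bar>u i x\<bar> \<partial>M)"
    and nn_integral_abs_suminf_le:
      "(\<integral>\<^sup>+ x. ennreal \<bar>\<Sum>i. u i x\<bar> \<partial>M) \<le> (\<integral>\<^sup>+ x. (\<Sum>i. ennreal \<bar>u i x\<bar>) \<partial>M)"
proof -
  note [measurable] = borel_measurable_integrable[OF u]
  have "AE x in M. (\<Sum>i. ennreal \<bar>u i x\<bar>) \<noteq> \<infinity>"
    using fin by (intro nn_integral_PInf_AE) auto
  then show *: "AE x in M. summable (\<lambda>i. \<bar>u i x\<bar>)"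
    by eventually_elim (auto intro: summable_suminf_not_top)
  have "(\<Sum>i. ennreal (\<integral>x. \<bar>u i x\<bar> \<partial>M)) = (\<Sum>i. \<integral>\<^sup>+ x. ennreal \<bar>u i x\<bar> \<partial>M)"
    using u by (simp add: nn_integral_eq_integral)
  also have "\<dots> = (\<integral>\<^sup>+ x. (\<Sum>i. ennreal \<bar>u i x\<bar>) \<partial>M)"
    by (rule nn_integral_suminf[symmetric]) simp
  finally show "summable (\<lambda>i. \<integral>x. \<bar>u i x\<bar> \<partial>M)"
    using fin by (intro summable_suminf_not_top) auto
  show "(\<integral>\<^sup>+ x. ennreal \<bar>\<Sum>i. u i x\<bar> \<partial>M) \<le> (\<integral>\<^sup>+ x. (\<Sum>i. ennreal \<bar>u i x\<bar>) \<partial>M)"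
    using *
  proof (intro nn_integral_mono_AE, eventually_elim)
    fix x assume x: "summable (\<lambda>i. \<bar>u i x\<bar>)"
    have "ennreal \<bar>\<Sum>i. u i x\<bar> \<le> ennreal (\<Sum>i. \<bar>u i x\<bar>)"
      using x by (intro ennreal_leI summable_rabs)
    also have "\<dots> = (\<Sum>i. ennreal \<bar>u i x\<bar>)"
      using x by (intro suminf_ennreal2[symmetric]) auto
    finally show "ennreal \<bar>\<Sum>i. u i x\<bar> \<le> (\<Sum>i. ennreal \<bar>u i x\<bar>)" .
  qed
qed

text \<open>Over a set of \<open>F\<close> the series is integrated term by term, and terms beyond
  \<open>n\<close> contribute nothing because their conditional expectation vanishes. For sums of
  martingale increments, the result is the partial sum up to time \<open>n\<close>.\<close>

lemma (in sigma_finite_subalgebra) real_cond_exp_suminf_finite: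
  fixes u :: "nat \<Rightarrow> 'a \<Rightarrow> real"
  assumes u: "\<And>i. integrable M (u i)"
    and fin: "(\<integral>\<^sup>+ x. (\<Sum>i. ennreal \<bar>u i x\<bar>) \<partial>M) < \<infinity>"
    and head: "\<And>i. i \<le> n \<Longrightarrow> AE x in M. real_cond_exp M F (u i) x = v i x"
    and tail: "\<And>i. i > n \<Longrightarrow> AE x in M. real_cond_exp M F (u i) x = 0"
  shows "integrable M (\<lambda>x. \<Sum>i. u i x)"
    and "AE x in M. real_cond_exp M F (\<lambda>x. \<Sum>i. u i x) x = (\<Sum>i\<le>n. v i x)"
proof -
  note [measurable] = borel_measurable_integrable[OF u]
  note s1 = AE_summable_of_nn_integral[OF u fin] and s2 = summable_integral_of_nn_integral[OF u fin]
  show i1: "integrable M (\<lambda>x. \<Sum>i. u i x)"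
    using s1 s2 u by (intro integrable_suminf) auto
  have "AE x in M. real_cond_exp M F (\<lambda>x. \<Sum>i. u i x) x = (\<Sum>i\<le>n. real_cond_exp M F (u i) x)"
  proof (rule real_cond_exp_charact)
    fix A assume A: "A \<in> sets F"
    then have [measurable]: "A \<in> sets M" using subalg by (auto simp: subalgebra_def)
    have iA: "integrable M (\<lambda>x. indicator A x * u i x)" "integrable M (\<lambda>x. indicator A x * \<bar>u i x\<bar>)" for i
      using integrable_mult_indicator[OF _ u[of i], of A]
        integrable_mult_indicator[OF _ integrable_abs[OF u[of i]], of A] by simp_all
    have "(\<integral>x\<in>A. (\<Sum>i. u i x) \<partial>M) = (\<integral>x. (\<Sum>i. indicator A x * u i x) \<partial>M)"
      unfolding set_lebesgue_integral_def using s1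
      by (intro integral_cong_AE) (auto simp: suminf_mult summable_rabs_cancel)
    also have "\<dots> = (\<Sum>i. \<integral>x. indicator A x * u i x \<partial>M)"
    proof (intro integral_suminf iA)
      show "AE x in M. summable (\<lambda>i. norm (indicator A x * u i x))"
        using s1 by eventually_elim (auto intro: summable_mult simp: abs_mult)
      show "summable (\<lambda>i. \<integral>x. norm (indicator A x * u i x) \<partial>M)"
        using u iA
        by (intro summable_comparison_test'[OF s2, of 0])
          (auto simp: abs_mult intro!: integral_mono_AE AE_I2 split: split_indicator)
    qed
    also have "\<dots> = (\<Sum>i\<le>n. \<integral>x. indicator A x * u i x \<partial>M)"
    proof (rule suminf_finite)
      fix i assume "i \<notin> {..n}"
      then have "AE x in M. real_cond_exp M F (u i) x = 0" using tail by auto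
      then have "(\<integral>x\<in>A. real_cond_exp M F (u i) x \<partial>M) = (\<integral>x. 0 \<partial>M)"
        unfolding set_lebesgue_integral_def by (intro integral_cong_AE) auto
      then show "(\<integral>x. indicator A x * u i x \<partial>M) = 0"
        using real_cond_exp_intA[OF u A, of i] by (simp add: set_lebesgue_integral_def)
    qed simp
    also have "\<dots> = (\<Sum>i\<le>n. \<integral>x\<in>A. real_cond_exp M F (u i) x \<partial>M)"
      using real_cond_exp_intA[OF u A] by (simp add: set_lebesgue_integral_def)
    also have "\<dots> = (\<integral>x\<in>A. (\<Sum>i\<le>n. real_cond_exp M F (u i) x) \<partial>M)"
      unfolding set_lebesgue_integral_def scaleR_sum_right
      using u by (intro Bochner_Integration.integral_sum[symmetric] integrable_mult_indicator) auto
    finally show "(\<integral>x\<in>A. (\<Sum>i. u i x) \<partial>M) = (\<integral>x\<in>A. (\<Sum>i\<le>n. real_cond_exp M F (u i) x) \<partial>M)" .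
  qed (use i1 u in \<open>auto intro!: Bochner_Integration.integrable_sum\<close>)
  moreover have "AE x in M. \<forall>i\<in>{..n}. real_cond_exp M F (u i) x = v i x"
    using head by (intro AE_finite_allI) auto
  ultimately show "AE x in M. real_cond_exp M F (\<lambda>x. \<Sum>i. u i x) x = (\<Sum>i\<le>n. v i x)"
    by eventually_elim simp
qed

section \<open>Decomposition of a nonnegative function\<close>

text \<open>
  Times start at 0 here: \<open>G i\<close> plays the role of \<open>F (Suc i)\<close>. The factor \<open>alive n\<close> is the indicator of
  \<open>\<sigma> \<ge> n\<close> and \<open>stop n\<close> that of \<open>\<sigma> = n\<close>; \<open>K\<close> is the martingale \<open>m\<close> stopped at \<open>\<sigma>\<close>, written as the
  conditional expectations of \<open>k\<close> come out (see \<open>K_Suc\<close>).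
\<close>

locale nonneg_closed_martingale = prob_space M for M :: "'a measure" +
  fixes G :: "nat \<Rightarrow> 'a measure" and f :: "'a \<Rightarrow> real" and c :: real
  assumes subalg: "subalgebra M (G i)"
    and sets_mono: "i \<le> j \<Longrightarrow> sets (G i) \<subseteq> sets (G j)"
    and f_int: "integrable M f" and f_nonneg: "0 \<le> f x" and c_pos: "c > 0"
begin

sublocale cond: finite_measure_subalgebra M "G n" for n
  by (intro finite_measure_subalgebra.intro finite_measure_subalgebra_axioms.intro subalg) unfold_locales

lemma space_G: "space (G n) = space M"
  using subalg by (simp add: subalgebra_def)

lemma subalg_mono: "i \<le> j \<Longrightarrow> subalgebra (G j) (G i)"
  using sets_mono by (simp add: subalgebra_def space_G)

lemma measurable_M: "u \<in> measurable (G n) N \<Longrightarrow> u \<in> measurable M N"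
  using measurable_from_subalg[OF subalg] .

definition X :: "nat \<Rightarrow> 'a \<Rightarrow> real" where "X n = real_cond_exp M (G n) f"
definition Y :: "nat \<Rightarrow> 'a \<Rightarrow> real" where "Y n x = min (X n x) c"
text \<open>\<open>Y i - e i\<close> is the conditional drop of \<open>Y\<close> in one step, which
  makes \<open>a\<close> the compensator in the Doob decomposition.\<close>

definition e :: "nat \<Rightarrow> 'a \<Rightarrow> real" where "e n = real_cond_exp M (G n) (Y (Suc n))"
definition a :: "nat \<Rightarrow> 'a \<Rightarrow> real" where "a n x = (\<Sum>i<n. Y i x - e i x)"
definition m :: "nat \<Rightarrow> 'a \<Rightarrow> real" where "m n x = Y n x + a n x"
definition alive :: "nat \<Rightarrow> 'a \<Rightarrow> real" where "alive n x = (if \<forall>j<n. m j x < c then 1 else 0)"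
definition stop :: "nat \<Rightarrow> 'a \<Rightarrow> real" where "stop n x = alive n x - alive (Suc n) x"
text \<open>Increments of the stopped martingale \<open>X - m\<close>. The first one is the whole
  initial value, in accordance with the zero operator preceding the first conditional
  expectation.\<close>

definition dh :: "nat \<Rightarrow> 'a \<Rightarrow> real" where
  "dh n x = (case n of 0 \<Rightarrow> X 0 x - m 0 x
     | Suc i \<Rightarrow> alive n x * ((X n x - m n x) - (X i x - m i x)))"
text \<open>At most one \<open>stop n x\<close> is nonzero, so the sum over \<open>n\<close> is
  \<open>f\<close> minus \<open>X\<close> at the stopping time, and 0 on paths that are never
  stopped.\<close>

definition dg :: "nat \<Rightarrow> 'a \<Rightarrow> real" where "dg n x = stop n x * (f x - X n x)"
definition g :: "'a \<Rightarrow> real" where "g x = (\<Sum>i. dg i x)"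
definition h :: "'a \<Rightarrow> real" where "h x = (\<Sum>i. dh i x)"
text \<open>As a remainder, \<open>k\<close> makes \<open>f = g + h + k\<close> hold at every point,
  even where the series for \<open>h\<close> diverges and \<open>suminf\<close> has no meaningful
  value.\<close>

definition k :: "'a \<Rightarrow> real" where "k x = f x - g x - h x"
definition K :: "nat \<Rightarrow> 'a \<Rightarrow> real" where
  "K n x = X n x - (\<Sum>i\<le>n. stop i x * (X n x - X i x)) - (\<Sum>i\<le>n. dh i x)"

section \<open>Adaptedness and predictability\<close>

lemma f_meas[measurable]: "f \<in> borel_measurable M"
  using f_int by auto

lemma Y_le_X: "Y n x \<le> X n x"
  by (simp add: Y_def)

lemma X_adapted[measurable]: "i \<le> n \<Longrightarrow> X i \<in> borel_measurable (G n)"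
  unfolding X_def by (rule measurable_from_subalg[OF subalg_mono]) auto

lemma Y_adapted[measurable]: "i \<le> n \<Longrightarrow> Y i \<in> borel_measurable (G n)"
  unfolding Y_def by measurable

lemma e_adapted[measurable]: "i \<le> n \<Longrightarrow> e i \<in> borel_measurable (G n)"
  unfolding e_def by (rule measurable_from_subalg[OF subalg_mono]) auto

lemma a_predictable: "i \<le> Suc n \<Longrightarrow> a i \<in> borel_measurable (G n)"
  unfolding a_def by (intro borel_measurable_sum borel_measurable_diff Y_adapted e_adapted) auto

lemma m_adapted: "i \<le> n \<Longrightarrow> m i \<in> borel_measurable (G n)"
  unfolding m_def by (intro borel_measurable_add Y_adapted a_predictable) auto

text \<open>The test behind \<open>alive i\<close> involves \<open>m j\<close> for
  \<open>j < i\<close> only. Knowing it one step ahead allows it to be pulled out of the conditional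
  expectation in \<open>dh_cond_tail\<close>.\<close>

lemma alive_predictable: "i \<le> Suc n \<Longrightarrow> alive i \<in> borel_measurable (G n)"
proof (induction i)
  case 0
  then show ?case by (simp add: alive_def)
next
  case (Suc i)
  have "alive (Suc i) = (\<lambda>x. if m i x < c then alive i x else 0)"
    by (auto simp: alive_def fun_eq_iff less_Suc_eq)
  moreover have [measurable]: "m i \<in> borel_measurable (G n)" "alive i \<in> borel_measurable (G n)"
    using Suc by (auto intro: m_adapted)
  ultimately show ?case by simp
qed

lemma stop_adapted: "i \<le> n \<Longrightarrow> stop i \<in> borel_measurable (G n)"
  unfolding stop_def by (intro borel_measurable_diff alive_predictable) auto

lemma dh_adapted: "i \<le> n \<Longrightarrow> dh i \<in> borel_measurable (G n)"
  unfolding dh_def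
  by (cases i) (auto intro!: borel_measurable_times borel_measurable_diff X_adapted m_adapted alive_predictable)

lemmas meas_M [measurable] =
  measurable_M[OF X_adapted[OF order_refl]] measurable_M[OF Y_adapted[OF order_refl]]
  measurable_M[OF e_adapted[OF order_refl]] measurable_M[OF a_predictable[OF le_SucI[OF order_refl]]]
  measurable_M[OF m_adapted[OF order_refl]] measurable_M[OF alive_predictable[OF le_SucI[OF order_refl]]]
  measurable_M[OF stop_adapted[OF order_refl]] measurable_M[OF dh_adapted[OF order_refl]]

lemma alive_01: "alive n x = 0 \<or> alive n x = 1"
  by (simp add: alive_def)

lemma alive_Suc: "alive (Suc n) x = (if m n x < c then alive n x else 0)"
  by (auto simp: alive_def less_Suc_eq)

lemma stop_01: "stop n x = 0 \<or> stop n x = 1"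
  using alive_01[of n x] by (auto simp: stop_def alive_Suc)

lemma sum_stop: "(\<Sum>i<n. stop i x) = 1 - alive n x"
  by (induction n) (auto simp: stop_def, simp add: alive_def)

section \<open>Integrability of the processes\<close>

lemma X_int[intro]: "integrable M (X n)"
  unfolding X_def using f_int by (rule cond.real_cond_exp_int)

lemma Y_int[intro]: "integrable M (Y n)"
  unfolding Y_def[abs_def] by (intro integrable_min X_int) auto

lemma e_int[intro]: "integrable M (e n)"
  unfolding e_def using Y_int by (rule cond.real_cond_exp_int)

lemma a_int[intro]: "integrable M (a n)"
  unfolding a_def[abs_def] by (intro Bochner_Integration.integrable_sum Bochner_Integration.integrable_diff Y_int e_int)

lemma m_int[intro]: "integrable M (m n)"
  unfolding m_def[abs_def] by (intro Bochner_Integration.integrable_add Y_int a_int)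

lemma integrable_01_mult:
  assumes "integrable M u" "w \<in> borel_measurable M" "\<And>x. w x = 0 \<or> w x = (1::real)"
  shows "integrable M (\<lambda>x. w x * u x)"
proof (rule Bochner_Integration.integrable_bound[OF assms(1)])
  show "(\<lambda>x. w x * u x) \<in> borel_measurable M"
    using assms by auto
  show "AE x in M. norm (w x * u x) \<le> norm (u x)"
  proof (rule AE_I2)
    show "norm (w x * u x) \<le> norm (u x)" for x
      using assms(3)[of x] by auto
  qed
qed

lemma dg_int[intro]: "integrable M (dg n)"
  unfolding dg_def[abs_def]
  by (intro integrable_01_mult Bochner_Integration.integrable_diff f_int X_int stop_01) measurable

lemma dh_int[intro]: "integrable M (dh n)"
proof (cases n)
  case 0
  then show ?thesis by (auto simp: dh_def[abs_def])
next
  case (Suc i)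
  then show ?thesis unfolding dh_def[abs_def]
    by (auto intro!: integrable_01_mult alive_01 X_int m_int Bochner_Integration.integrable_diff)
qed

section \<open>Conditional expectations of the increments\<close>

lemma X_tower: "i \<le> n \<Longrightarrow> AE x in M. real_cond_exp M (G i) (X n) x = X i x"
  unfolding X_def by (intro cond.real_cond_exp_nested_subalg subalg subalg_mono f_int)

lemma X_known: "n \<le> i \<Longrightarrow> AE x in M. real_cond_exp M (G i) (X n) x = X n x"
  by (intro cond.real_cond_exp_F_meas X_int X_adapted)

text \<open>The factor \<open>w\<close> is pulled out given \<open>G i\<close>, and the tower
  property passes to the smaller \<open>G n\<close>. This is optional stopping at the level of
  increments, used for both \<open>dg\<close> and \<open>dh\<close>.\<close>

lemma cond_exp_mult_eq_0:
  assumes "n \<le> i" and u: "integrable M u" "AE x in M. real_cond_exp M (G i) u x = 0"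
    and w: "w \<in> borel_measurable (G i)" "\<And>x. w x = 0 \<or> w x = (1::real)"
  shows "AE x in M. real_cond_exp M (G n) (\<lambda>x. w x * u x) x = 0"
proof -
  have wu: "integrable M (\<lambda>x. w x * u x)"
    using u(1) measurable_M[OF w(1)] w(2) by (rule integrable_01_mult)
  have "AE x in M. real_cond_exp M (G i) (\<lambda>x. w x * u x) x = w x * real_cond_exp M (G i) u x"
    using u wu w by (intro cond.real_cond_exp_mult) auto
  then have "AE x in M. real_cond_exp M (G i) (\<lambda>x. w x * u x) x = 0"
    using u(2) by eventually_elim simp
  then have "AE x in M. real_cond_exp M (G n) (real_cond_exp M (G i) (\<lambda>x. w x * u x)) x = real_cond_exp M (G n) (\<lambda>_. 0) x"
    using wu by (intro cond.real_cond_exp_cong) auto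
  moreover have "AE x in M. real_cond_exp M (G n) (\<lambda>_. 0) x = 0"
    by (intro cond.real_cond_exp_F_meas) auto
  moreover have "AE x in M. real_cond_exp M (G n) (real_cond_exp M (G i) (\<lambda>x. w x * u x)) x = real_cond_exp M (G n) (\<lambda>x. w x * u x) x"
    using wu assms(1) by (intro cond.real_cond_exp_nested_subalg subalg subalg_mono)
  ultimately show ?thesis by eventually_elim simp
qed

lemma dg_cond_tail:
  assumes "n < i" shows "AE x in M. real_cond_exp M (G n) (dg i) x = 0"
  unfolding dg_def[abs_def]
proof (rule cond_exp_mult_eq_0[where i=i])
  have "AE x in M. real_cond_exp M (G i) (\<lambda>x. f x - X i x) x = real_cond_exp M (G i) f x - real_cond_exp M (G i) (X i) x"
    by (intro cond.real_cond_exp_diff f_int X_int)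
  then show "AE x in M. real_cond_exp M (G i) (\<lambda>x. f x - X i x) x = 0"
    using X_known[OF order_refl[of i]] by eventually_elim (simp add: X_def)
qed (use assms stop_01 in \<open>auto intro: f_int stop_adapted\<close>)

lemma dg_cond_head:
  assumes "i \<le> n" shows "AE x in M. real_cond_exp M (G n) (dg i) x = stop i x * (X n x - X i x)"
proof -
  have "AE x in M. real_cond_exp M (G n) (dg i) x = stop i x * real_cond_exp M (G n) (\<lambda>x. f x - X i x) x"
    unfolding dg_def[abs_def] using assms dg_int[of i]
    by (intro cond.real_cond_exp_mult stop_adapted) (auto simp: dg_def[abs_def])
  moreover have "AE x in M. real_cond_exp M (G n) (\<lambda>x. f x - X i x) x = real_cond_exp M (G n) f x - real_cond_exp M (G n) (X i) x"
    by (intro cond.real_cond_exp_diff f_int X_int)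
  ultimately show ?thesis
    using X_known[OF assms] by eventually_elim (simp add: X_def)
qed

lemma dh_cond_head:
  assumes "i \<le> n" shows "AE x in M. real_cond_exp M (G n) (dh i) x = dh i x"
  using assms by (intro cond.real_cond_exp_F_meas dh_int dh_adapted)

text \<open>Conditioning replaces \<open>Y (Suc n)\<close> by \<open>e n\<close>, and the last
  summand \<open>Y n - e n\<close> of \<open>a (Suc n)\<close> compensates exactly.\<close>

lemma m_martingale: "AE x in M. real_cond_exp M (G n) (m (Suc n)) x = m n x"
proof -
  have "AE x in M. real_cond_exp M (G n) (\<lambda>x. Y (Suc n) x + a (Suc n) x) x = real_cond_exp M (G n) (Y (Suc n)) x + real_cond_exp M (G n) (a (Suc n)) x"
    by (intro cond.real_cond_exp_add Y_int a_int)
  moreover have "AE x in M. real_cond_exp M (G n) (a (Suc n)) x = a (Suc n) x"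
    by (intro cond.real_cond_exp_F_meas a_int a_predictable) auto
  ultimately show ?thesis
    unfolding m_def[abs_def] by eventually_elim (simp add: a_def e_def)
qed

text \<open>\<open>X - m\<close> is a martingale, and \<open>alive i\<close> is known at time
  \<open>i - 1\<close>, which is at least \<open>n\<close>.\<close>

lemma dh_cond_tail:
  assumes "n < i" shows "AE x in M. real_cond_exp M (G n) (dh i) x = 0"
proof -
  obtain j where i: "i = Suc j" using assms by (cases i) auto
  let ?u = "\<lambda>x. (X i x - m i x) - (X j x - m j x)"
  have "AE x in M. real_cond_exp M (G j) ?u x = real_cond_exp M (G j) (\<lambda>x. X i x - m i x) x - real_cond_exp M (G j) (\<lambda>x. X j x - m j x) x"
    by (intro cond.real_cond_exp_diff Bochner_Integration.integrable_diff X_int m_int)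
  moreover have "AE x in M. real_cond_exp M (G j) (\<lambda>x. X i x - m i x) x = real_cond_exp M (G j) (X i) x - real_cond_exp M (G j) (m i) x"
    by (intro cond.real_cond_exp_diff X_int m_int)
  moreover have "AE x in M. real_cond_exp M (G j) (\<lambda>x. X j x - m j x) x = X j x - m j x"
    by (intro cond.real_cond_exp_F_meas Bochner_Integration.integrable_diff borel_measurable_diff X_int m_int X_adapted m_adapted order_refl)
  ultimately have "AE x in M. real_cond_exp M (G j) ?u x = 0"
    using X_tower[of j i, unfolded i, OF le_SucI[OF order_refl]] m_martingale[of j] unfolding i
    by eventually_elim simp
  then have "AE x in M. real_cond_exp M (G n) (\<lambda>x. alive i x * ?u x) x = 0"
    using assms i by (intro cond_exp_mult_eq_0[where i=j] Bochner_Integration.integrable_diff X_int m_int alive_predictable alive_01) auto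
  then show ?thesis by (simp add: dh_def[abs_def] i)
qed

text \<open>One null set serves all times, so that later estimates can be made path by path.
  \<open>e n \<le> Y n\<close> is the supermartingale property: \<open>e n\<close> is at most
  \<open>c\<close> by truncation and at most \<open>X n\<close> because \<open>X\<close> is a
  martingale.\<close>

lemma AE_bounds:
  "AE x in M. \<forall>n. 0 \<le> X n x \<and> 0 \<le> e n x \<and> e n x \<le> Y n x"
proof (subst AE_all_countable, intro allI)
  fix n
  have X0: "AE x in M. 0 \<le> X i x" for i
    unfolding X_def using f_nonneg by (intro cond.real_cond_exp_pos) auto
  have "AE x in M. 0 \<le> e n x"
    unfolding e_def using X0[of "Suc n"] c_pos
    by (intro cond.real_cond_exp_pos) (auto simp: Y_def elim: eventually_mono)
  moreover have "AE x in M. e n x \<le> c"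
    unfolding e_def by (intro cond.real_cond_exp_le_c Y_int) (auto simp: Y_def)
  moreover have "AE x in M. e n x \<le> real_cond_exp M (G n) (X (Suc n)) x"
    unfolding e_def by (intro cond.real_cond_exp_mono Y_int X_int) (auto simp: Y_def)
  ultimately show "AE x in M. 0 \<le> X n x \<and> 0 \<le> e n x \<and> e n x \<le> Y n x"
    using X0[of n] X_tower[of n "Suc n", simplified] by eventually_elim (auto simp: Y_def)
qed

section \<open>Pathwise estimates\<close>

context
  fixes x
  assumes b: "\<forall>n. 0 \<le> X n x \<and> 0 \<le> e n x \<and> e n x \<le> Y n x"
begin

lemma a_mono: "a n x \<le> a (Suc n) x"
  using b by (simp add: a_def)

lemma a_nonneg: "0 \<le> a n x"
  using b by (simp add: a_def sum_nonneg)

text \<open>The term \<open>Y n\<close> of \<open>m n\<close> covers the increment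
  \<open>Y n - e n\<close>, since \<open>e n\<close> is nonnegative. Hence the next value of
  \<open>m\<close> exceeds the present one by at most \<open>c\<close>.\<close>

lemma a_Suc_le_m: "a (Suc n) x \<le> m n x"
  using b by (simp add: a_def m_def)

lemma Y_nonneg: "0 \<le> Y n x"
  using b c_pos by (simp add: Y_def)

lemma X_eq_Y: assumes "m n x < c" shows "X n x = Y n x"
  using assms a_nonneg[of n] by (auto simp: m_def Y_def)

text \<open>Before the stopping time \<open>X = Y\<close>, so the increments of \<open>X - m\<close>
  are those of \<open>- a\<close> and their sizes telescope. At the stopping time a term
  \<open>X - Y\<close> between 0 and \<open>X\<close> is added, and afterwards nothing.\<close>

lemma abs_dh_sum_le: "(\<Sum>i<Suc n. \<bar>dh i x\<bar>) \<le> (\<Sum>i<Suc n. stop i x * X i x) + a n x"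
proof (induction n)
  case 0
  show ?case
    using b c_pos X_eq_Y[of 0] by (auto simp: dh_def stop_def alive_def m_def a_def Y_def)
next
  case (Suc n)
  have "\<bar>dh (Suc n) x\<bar> \<le> stop (Suc n) x * X (Suc n) x + (a (Suc n) x - a n x)"
  proof (cases "alive (Suc n) x = 1")
    case True
    then have "m n x < c" by (auto simp: alive_Suc split: if_splits)
    then have d: "dh (Suc n) x = (X (Suc n) x - Y (Suc n) x) - (a (Suc n) x - a n x)"
      using X_eq_Y[of n] True by (simp add: dh_def m_def)
    show ?thesis
    proof (cases "m (Suc n) x < c")
      case True
      then show ?thesis
        using d X_eq_Y[of "Suc n"] a_mono[of n] by (simp add: stop_def alive_Suc[of "Suc n"])
    next
      case False
      then have "stop (Suc n) x = 1" using \<open>alive (Suc n) x = 1\<close> by (simp add: stop_def alive_Suc[of "Suc n"])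
      then show ?thesis
        using d a_mono[of n] Y_nonneg[of "Suc n"] Y_le_X[of "Suc n" x] by (simp add: abs_le_iff)
    qed
  next
    case False
    then have "alive (Suc n) x = 0" using alive_01 by metis
    then show ?thesis using a_mono[of n] by (simp add: dh_def stop_def alive_Suc[of "Suc n"])
  qed
  with Suc show ?case by simp
qed

lemma K_0: "K 0 x = m 0 x"
  by (simp add: K_def dh_def)

text \<open>On stopped paths the sum belonging to \<open>g\<close> cancels the increment of
  \<open>X\<close>; on live paths \<open>dh\<close> removes the increment of \<open>X - m\<close>.
  What survives is the increment of \<open>m\<close> on live paths.\<close>

lemma K_Suc: "K (Suc n) x = K n x + alive (Suc n) x * (m (Suc n) x - m n x)"
proof -
  have "(\<Sum>i\<le>Suc n. stop i x * (X (Suc n) x - X i x))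
      = (\<Sum>i\<le>n. stop i x * (X n x - X i x)) + (\<Sum>i\<le>n. stop i x * (X (Suc n) x - X n x))"
    by (simp add: sum.distrib[symmetric] algebra_simps)
  also have "(\<Sum>i\<le>n. stop i x * (X (Suc n) x - X n x)) = (1 - alive (Suc n) x) * (X (Suc n) x - X n x)"
    by (simp add: sum_distrib_right[symmetric] lessThan_Suc_atMost[symmetric] sum_stop del: sum.lessThan_Suc)
  finally show ?thesis
    unfolding K_def by (simp add: dh_def algebra_simps)
qed

text \<open>\<open>K\<close> follows \<open>m\<close> up to the first crossing of \<open>c\<close>,
  overshoots to at most \<open>2 * c\<close> by \<open>a_Suc_le_m\<close>, and is frozen afterwards.
  The lower bound \<open>c\<close> on stopped paths serves the maximal inequality in
  \<open>bad_le\<close>.\<close>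

lemma K_bounds:
  "(alive (Suc n) x = 1 \<longrightarrow> K n x = m n x) \<and> (alive (Suc n) x = 0 \<longrightarrow> c \<le> K n x) \<and> 0 \<le> K n x \<and> K n x \<le> 2 * c"
proof (induction n)
  case 0
  show ?case using Y_nonneg[of 0] c_pos
    by (auto simp: K_0 m_def a_def alive_def Y_def)
next
  case (Suc n)
  show ?case
  proof (cases "alive (Suc n) x = 1")
    case True
    then have "m n x < c" by (auto simp: alive_Suc split: if_splits)
    then show ?thesis
      using Suc True a_Suc_le_m[of n] a_nonneg[of "Suc n"] Y_nonneg[of "Suc n"]
      by (auto simp: K_Suc alive_Suc[of "Suc n"] m_def[of "Suc n"]) (auto simp: Y_def)
  next
    case False
    then have "alive (Suc n) x = 0" using alive_01 by metis
    then show ?thesis using Suc by (simp add: K_Suc alive_Suc[of "Suc n"])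
  qed
qed

end

section \<open>Bounds on means and on the two series\<close>

lemma stop_mult_f_int: "integrable M (\<lambda>x. stop i x * f x)"
  by (intro integrable_01_mult f_int stop_01) measurable

lemma stop_mult_X_int: "integrable M (\<lambda>x. stop i x * X i x)"
  by (intro integrable_01_mult X_int stop_01) measurable

text \<open>The two sides differ by the integral of \<open>dg i\<close>, whose conditional
  expectation given \<open>G i\<close> vanishes.\<close>

lemma integral_stop_mult_X: "(\<integral>x. stop i x * X i x \<partial>M) = (\<integral>x. stop i x * f x \<partial>M)"
proof -
  have "(\<integral>x. dg i x \<partial>M) = (\<integral>x. real_cond_exp M (G i) (dg i) x \<partial>M)"
    by (rule cond.real_cond_exp_int(2)[symmetric]) (rule dg_int)
  also have "\<dots> = (\<integral>x. 0 \<partial>M)"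
    using dg_cond_head[OF order_refl, of i] by (intro integral_cong_AE) auto
  finally show ?thesis
    using stop_mult_f_int[of i] stop_mult_X_int[of i]
    by (simp add: dg_def[abs_def] right_diff_distrib)
qed

lemma sum_integral_stop_le: "(\<Sum>i<n. \<integral>x. stop i x * f x \<partial>M) \<le> (\<integral>x. f x \<partial>M)"
proof -
  have "(\<Sum>i<n. \<integral>x. stop i x * f x \<partial>M) = (\<integral>x. (\<Sum>i<n. stop i x) * f x \<partial>M)"
    unfolding sum_distrib_right
    by (intro Bochner_Integration.integral_sum[symmetric] stop_mult_f_int)
  also have "\<dots> \<le> (\<integral>x. f x \<partial>M)"
  proof (rule integral_mono)
    show "integrable M (\<lambda>x. (\<Sum>i<n. stop i x) * f x)"
      unfolding sum_distrib_right by (intro Bochner_Integration.integrable_sum stop_mult_f_int)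
    show "(\<Sum>i<n. stop i x) * f x \<le> f x" for x
      using alive_01[of n x] f_nonneg[of x] by (auto simp: sum_stop)
  qed (rule f_int)
  finally show ?thesis .
qed

lemma integral_X: "(\<integral>x. X n x \<partial>M) = (\<integral>x. f x \<partial>M)"
  unfolding X_def by (rule cond.real_cond_exp_int(2)[OF f_int])

lemma integral_Y_le: "(\<integral>x. Y n x \<partial>M) \<le> (\<integral>x. f x \<partial>M)"
  unfolding integral_X[of n, symmetric] by (intro integral_mono Y_int X_int) (simp add: Y_def)

text \<open>\<open>e i\<close> and \<open>Y (Suc i)\<close> have the same mean, so the sum
  telescopes to the total decrease of the means of \<open>Y\<close>.\<close>

lemma integral_a_le: "(\<integral>x. a n x \<partial>M) \<le> (\<integral>x. f x \<partial>M)"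
proof -
  have "(\<integral>x. e i x \<partial>M) = (\<integral>x. Y (Suc i) x \<partial>M)" for i
    unfolding e_def by (rule cond.real_cond_exp_int(2)[OF Y_int])
  then have "(\<integral>x. a n x \<partial>M) = (\<Sum>i<n. (\<integral>x. Y i x \<partial>M) - (\<integral>x. Y (Suc i) x \<partial>M))"
    unfolding a_def[abs_def]
    by (subst Bochner_Integration.integral_sum)
      (simp_all add: Bochner_Integration.integral_diff Y_int e_int)
  also have "\<dots> = (\<integral>x. Y 0 x \<partial>M) - (\<integral>x. Y n x \<partial>M)"
    by (rule sum_lessThan_telescope')
  also have "\<dots> \<le> (\<integral>x. f x \<partial>M)"
  proof -
    have "0 \<le> (\<integral>x. Y n x \<partial>M)"
      using AE_bounds by (intro integral_nonneg_AE) (auto elim!: eventually_mono intro: Y_nonneg)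
    then show ?thesis using integral_Y_le[of 0] by linarith
  qed
  finally show ?thesis .
qed

lemma nn_integral_dg_le: "(\<integral>\<^sup>+x. (\<Sum>i. ennreal \<bar>dg i x\<bar>) \<partial>M) \<le> ennreal (2 * (\<integral>x. f x \<partial>M))"
proof (rule nn_integral_suminf_le_of_sum_integral_le)
  fix n
  have "(\<Sum>i<n. \<integral>x. \<bar>dg i x\<bar> \<partial>M) \<le> (\<Sum>i<n. \<integral>x. stop i x * f x + stop i x * X i x \<partial>M)"
  proof (intro sum_mono integral_mono_AE)
    fix i
    show "AE x in M. \<bar>dg i x\<bar> \<le> stop i x * f x + stop i x * X i x"
      using AE_bounds
    proof eventually_elim
      fix x assume "\<forall>n. 0 \<le> X n x \<and> 0 \<le> e n x \<and> e n x \<le> Y n x"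
      then show "\<bar>dg i x\<bar> \<le> stop i x * f x + stop i x * X i x"
        using stop_01[of i x] f_nonneg[of x] by (auto simp: dg_def abs_le_iff algebra_simps add_increasing)
    qed
  qed (auto intro: dg_int stop_mult_f_int stop_mult_X_int)
  also have "\<dots> = 2 * (\<Sum>i<n. \<integral>x. stop i x * f x \<partial>M)"
    by (simp add: Bochner_Integration.integral_add stop_mult_f_int stop_mult_X_int integral_stop_mult_X sum_distrib_left)
  also have "\<dots> \<le> 2 * (\<integral>x. f x \<partial>M)"
    using sum_integral_stop_le[of n] by simp
  finally show "(\<Sum>i<n. \<integral>x. \<bar>dg i x\<bar> \<partial>M) \<le> 2 * (\<integral>x. f x \<partial>M)" .
qed (auto intro: dg_int)

text \<open>One copy of the integral of \<open>f\<close> pays for the jump at the stopping time, the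
  other for the compensator \<open>a\<close>.\<close>

lemma nn_integral_dh_le: "(\<integral>\<^sup>+x. (\<Sum>i. ennreal \<bar>dh i x\<bar>) \<partial>M) \<le> ennreal (2 * (\<integral>x. f x \<partial>M))"
proof (rule nn_integral_suminf_le_of_sum_integral_le)
  fix n
  \<comment> \<open>The extra term brings the sum into the shape of
    \<open>abs_dh_sum_le\<close>.\<close>
  have "(\<Sum>i<n. \<integral>x. \<bar>dh i x\<bar> \<partial>M) \<le> (\<Sum>i<Suc n. \<integral>x. \<bar>dh i x\<bar> \<partial>M)"
    by simp
  also have "\<dots> = (\<integral>x. (\<Sum>i<Suc n. \<bar>dh i x\<bar>) \<partial>M)"
    by (intro Bochner_Integration.integral_sum[symmetric] integrable_abs dh_int)
  also have "\<dots> \<le> (\<integral>x. (\<Sum>i<Suc n. stop i x * X i x) + a n x \<partial>M)"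
    using AE_bounds
    by (intro integral_mono_AE Bochner_Integration.integrable_sum Bochner_Integration.integrable_add
        integrable_abs dh_int stop_mult_X_int a_int) (auto elim!: eventually_mono dest: abs_dh_sum_le simp del: sum.lessThan_Suc)
  also have "\<dots> = (\<integral>x. (\<Sum>i<Suc n. stop i x * X i x) \<partial>M) + (\<integral>x. a n x \<partial>M)"
    by (intro Bochner_Integration.integral_add Bochner_Integration.integrable_sum stop_mult_X_int a_int)
  also have "(\<integral>x. (\<Sum>i<Suc n. stop i x * X i x) \<partial>M) = (\<Sum>i<Suc n. \<integral>x. stop i x * f x \<partial>M)"
    unfolding integral_stop_mult_X[symmetric]
    by (intro Bochner_Integration.integral_sum stop_mult_X_int)
  also have "\<dots> \<le> (\<integral>x. f x \<partial>M)" by (rule sum_integral_stop_le)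
  finally show "(\<Sum>i<n. \<integral>x. \<bar>dh i x\<bar> \<partial>M) \<le> 2 * (\<integral>x. f x \<partial>M)"
    using integral_a_le[of n] by linarith
qed (auto intro: dh_int)

lemma nn_integral_dg_finite: "(\<integral>\<^sup>+x. (\<Sum>i. ennreal \<bar>dg i x\<bar>) \<partial>M) < \<infinity>"
  by (rule le_less_trans[OF nn_integral_dg_le]) simp

lemma nn_integral_dh_finite: "(\<integral>\<^sup>+x. (\<Sum>i. ennreal \<bar>dh i x\<bar>) \<partial>M) < \<infinity>"
  by (rule le_less_trans[OF nn_integral_dh_le]) simp

section \<open>Conditional expectations and integrability of \<open>g\<close>, \<open>h\<close> and
  \<open>k\<close>\<close>

lemma cond_exp_g: "AE x in M. real_cond_exp M (G n) g x = (\<Sum>i\<le>n. stop i x * (X n x - X i x))"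
  unfolding g_def[abs_def]
  by (intro cond.real_cond_exp_suminf_finite(2) nn_integral_dg_finite dg_int dg_cond_head dg_cond_tail)

lemma cond_exp_h: "AE x in M. real_cond_exp M (G n) h x = (\<Sum>i\<le>n. dh i x)"
  unfolding h_def[abs_def]
  by (intro cond.real_cond_exp_suminf_finite(2) nn_integral_dh_finite dh_int dh_cond_head dh_cond_tail)

lemma g_int: "integrable M g"
  unfolding g_def[abs_def]
  by (rule cond.real_cond_exp_suminf_finite(1)[OF dg_int nn_integral_dg_finite dg_cond_head dg_cond_tail])

lemma h_int: "integrable M h"
  unfolding h_def[abs_def]
  by (rule cond.real_cond_exp_suminf_finite(1)[OF dh_int nn_integral_dh_finite dh_cond_head dh_cond_tail])

lemma k_int: "integrable M k"
  unfolding k_def[abs_def] by (intro Bochner_Integration.integrable_diff f_int g_int h_int)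

lemma nn_integral_g_le: "(\<integral>\<^sup>+x. ennreal \<bar>g x\<bar> \<partial>M) \<le> ennreal (2 * (\<integral>x. f x \<partial>M))"
  unfolding g_def
  by (rule order_trans[OF nn_integral_abs_suminf_le[OF dg_int nn_integral_dg_finite] nn_integral_dg_le])

lemma nn_integral_h_le: "(\<integral>\<^sup>+x. ennreal \<bar>h x\<bar> \<partial>M) \<le> ennreal (2 * (\<integral>x. f x \<partial>M))"
  unfolding h_def
  by (rule order_trans[OF nn_integral_abs_suminf_le[OF dh_int nn_integral_dh_finite] nn_integral_dh_le])

lemma cond_exp_k: "AE x in M. real_cond_exp M (G n) k x = K n x"
proof -
  have "AE x in M. real_cond_exp M (G n) k x = real_cond_exp M (G n) (\<lambda>x. f x - g x) x - real_cond_exp M (G n) h x"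
    unfolding k_def[abs_def] by (intro cond.real_cond_exp_diff Bochner_Integration.integrable_diff f_int g_int h_int)
  moreover have "AE x in M. real_cond_exp M (G n) (\<lambda>x. f x - g x) x = real_cond_exp M (G n) f x - real_cond_exp M (G n) g x"
    by (intro cond.real_cond_exp_diff f_int g_int)
  ultimately show ?thesis
    using cond_exp_g[of n] cond_exp_h[of n] by eventually_elim (simp add: K_def X_def)
qed

text \<open>Conditioning on \<open>G 0\<close> preserves the mean, and \<open>K 0\<close> is just
  the truncation \<open>Y 0\<close>.\<close>

lemma integral_k_le: "(\<integral>x. k x \<partial>M) \<le> (\<integral>x. f x \<partial>M)"
proof -
  have "(\<integral>x. k x \<partial>M) = (\<integral>x. real_cond_exp M (G 0) k x \<partial>M)"
    by (rule cond.real_cond_exp_int(2)[symmetric, OF k_int])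
  also have "\<dots> = (\<integral>x. Y 0 x \<partial>M)"
    using cond_exp_k[of 0] AE_bounds
    by (intro integral_cong_AE) (auto simp: K_0 m_def a_def)
  finally show ?thesis using integral_Y_le[of 0] by simp
qed

section \<open>The limit \<sigma>-algebra and the bounds on \<open>k\<close>\<close>

definition G_inf :: "'a measure" where "G_inf = sigma (space M) (\<Union>i. sets (G i))"

text \<open>Two members of the union lie in a common \<open>G (max i j)\<close>. The union need not
  be a \<sigma>-algebra, hence the approximation by members of an algebra.\<close>

lemma algebra_Union: "algebra (space M) (\<Union>i. sets (G i))"
  unfolding algebra_iff_Un
proof (intro conjI ballI)
  show "(\<Union>i. sets (G i)) \<subseteq> Pow (space M)"
    using sets.space_closed[of "G _"] by (auto simp: space_G)
  show "{} \<in> (\<Union>i. sets (G i))" by auto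
  show "space M - A \<in> (\<Union>i. sets (G i))" if "A \<in> (\<Union>i. sets (G i))" for A
    using that sets.compl_sets[of A "G _"] by (auto simp: space_G)
  fix A B assume "A \<in> (\<Union>i. sets (G i))" "B \<in> (\<Union>i. sets (G i))"
  then obtain i j where "A \<in> sets (G i)" "B \<in> sets (G j)" by blast
  then have "A \<in> sets (G (max i j))" "B \<in> sets (G (max i j))"
    using sets_mono[of i "max i j"] sets_mono[of j "max i j"] by auto
  then show "A \<union> B \<in> (\<Union>i. sets (G i))" by blast
qed

lemma measurable_G_inf: "u \<in> borel_measurable (G n) \<Longrightarrow> u \<in> borel_measurable G_inf"
proof (rule measurable_from_subalg)
  have "(\<Union>i. sets (G i)) \<subseteq> Pow (space M)"
    using sets.space_closed[of "G _"] by (auto simp: space_G)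
  then show "subalgebra G_inf (G n)"
    by (auto simp: subalgebra_def G_inf_def space_G space_measure_of sets_measure_of intro: sigma_sets.Basic)
qed

text \<open>Used instead of the martingale convergence theorem to bound \<open>k\<close> by its conditional expectations.\<close>

lemma AE_nonneg_if_cond_exp_nonneg:
  assumes u: "integrable M u" "u \<in> borel_measurable G_inf"
    and pos: "\<And>n. AE x in M. 0 \<le> real_cond_exp M (G n) u x"
  shows "AE x in M. 0 \<le> u x"
proof (rule AE_nonneg_if_integral_nonneg_on_algebra[OF algebra_Union _ u[unfolded G_inf_def]])
  show "(\<Union>i. sets (G i)) \<subseteq> sets M"
    using subalg by (auto simp: subalgebra_def)
  fix B assume "B \<in> (\<Union>i. sets (G i))"
  then obtain n where B: "B \<in> sets (G n)" by blast
  have "(\<integral>x\<in>B. u x \<partial>M) = (\<integral>x\<in>B. real_cond_exp M (G n) u x \<partial>M)"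
    by (rule cond.real_cond_exp_intA[OF u(1) B])
  also have "\<dots> \<ge> 0"
    unfolding set_lebesgue_integral_def using pos[of n] by (intro integral_nonneg_AE) auto
  finally show "0 \<le> (\<integral>x\<in>B. u x \<partial>M)" .
qed

lemma dg_meas_inf: "f \<in> borel_measurable G_inf \<Longrightarrow> dg n \<in> borel_measurable G_inf"
  unfolding dg_def[abs_def]
  by (intro borel_measurable_times borel_measurable_diff measurable_G_inf[OF stop_adapted[OF order_refl]]
      measurable_G_inf[OF X_adapted[OF order_refl]])

lemma g_meas_inf: "f \<in> borel_measurable G_inf \<Longrightarrow> g \<in> borel_measurable G_inf"
  unfolding g_def[abs_def] by (intro borel_measurable_suminf dg_meas_inf)

lemma h_meas_inf: "h \<in> borel_measurable G_inf"
  unfolding h_def[abs_def] by (intro borel_measurable_suminf measurable_G_inf[OF dh_adapted[OF order_refl]])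

lemma k_meas_inf: "f \<in> borel_measurable G_inf \<Longrightarrow> k \<in> borel_measurable G_inf"
  unfolding k_def[abs_def] by (intro borel_measurable_diff g_meas_inf h_meas_inf)

text \<open>The conditional expectations of \<open>k\<close> and \<open>2 * c - k\<close> are
  \<open>K n\<close> and \<open>2 * c - K n\<close>, nonnegative at every time by
  \<open>K_bounds\<close>.\<close>

lemma k_bounds:
  assumes "f \<in> borel_measurable G_inf"
  shows "AE x in M. 0 \<le> k x \<and> k x \<le> 2 * c"
proof -
  have "AE x in M. 0 \<le> k x"
  proof (rule AE_nonneg_if_cond_exp_nonneg[OF k_int k_meas_inf[OF assms]])
    show "AE x in M. 0 \<le> real_cond_exp M (G n) k x" for n
      using AE_bounds cond_exp_k[of n] by eventually_elim (use K_bounds in auto)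
  qed
  moreover have "AE x in M. 0 \<le> 2 * c - k x"
  proof (rule AE_nonneg_if_cond_exp_nonneg)
    fix n
    have "AE x in M. real_cond_exp M (G n) (\<lambda>x. 2 * c - k x) x = real_cond_exp M (G n) (\<lambda>x. 2 * c) x - real_cond_exp M (G n) k x"
      by (intro cond.real_cond_exp_diff k_int) simp
    moreover have "AE x in M. real_cond_exp M (G n) (\<lambda>x. 2 * c) x = 2 * c"
      by (intro cond.real_cond_exp_F_meas) auto
    ultimately show "AE x in M. 0 \<le> real_cond_exp M (G n) (\<lambda>x. 2 * c - k x) x"
      using AE_bounds cond_exp_k[of n] by eventually_elim (use K_bounds in auto)
  qed (use k_int k_meas_inf[OF assms] in auto)
  ultimately show ?thesis by eventually_elim simp
qed

section \<open>The exceptional event for \<open>g\<close>\<close>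

text \<open>\<open>alive (Suc n) x = 0\<close> says that stopping occurs by time \<open>n\<close>,
  so this is the event of a finite stopping time.\<close>

definition bad :: "'a set" where "bad = {x \<in> space M. \<exists>n. alive (Suc n) x = 0}"

lemma bad_sets: "bad \<in> sets M"
  unfolding bad_def by measurable

lemma cond_exp_g_eq_0: "AE x in M. x \<notin> bad \<longrightarrow> (\<forall>n. real_cond_exp M (G n) g x = 0)"
proof -
  have "AE x in M. \<forall>n. real_cond_exp M (G n) g x = (\<Sum>i\<le>n. stop i x * (X n x - X i x))"
    using cond_exp_g by (simp add: AE_all_countable)
  then show ?thesis
    using AE_space
  proof eventually_elim
    fix x assume eq: "\<forall>n. real_cond_exp M (G n) g x = (\<Sum>i\<le>n. stop i x * (X n x - X i x))" and "x \<in> space M"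
    have "stop i x = 0" if "x \<notin> bad" for i
    proof -
      have "alive (Suc j) x = 1" for j
        using that \<open>x \<in> space M\<close> alive_01[of "Suc j" x] by (auto simp: bad_def)
      moreover have "alive 0 x = 1" by (simp add: alive_def)
      ultimately have "alive j x = 1" for j by (cases j) auto
      then show ?thesis by (simp add: stop_def)
    qed
    then show "x \<notin> bad \<longrightarrow> (\<forall>n. real_cond_exp M (G n) g x = 0)"
      by (simp add: eq)
  qed
qed

text \<open>Doob's maximal inequality for the stopped martingale: \<open>K n\<close> is nonnegative,
  at least \<open>c\<close> on paths stopped by time \<open>n\<close>, and of mean at most that of
  \<open>f\<close>. These events increase to \<open>bad\<close>.\<close>

lemma bad_le: "emeasure M bad \<le> ennreal ((\<integral>x. f x \<partial>M) / c)"
proof -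
  let ?N = "\<lambda>n. {x \<in> space M. alive (Suc n) x = 0}"
  have "emeasure M (?N n) \<le> ennreal ((\<integral>x. f x \<partial>M) / c)" for n
  proof -
    have "c * measure M (?N n) = (\<integral>x. c * indicator (?N n) x \<partial>M)"
      by simp
    also have "\<dots> \<le> (\<integral>x. real_cond_exp M (G n) k x \<partial>M)"
    proof (rule integral_mono_AE)
      show "AE x in M. c * indicator (?N n) x \<le> real_cond_exp M (G n) k x"
        using AE_bounds cond_exp_k[of n]
        by eventually_elim (use K_bounds[of _ n] in \<open>auto split: split_indicator\<close>)
    qed (auto intro!: cond.real_cond_exp_int(1) k_int integrable_real_indicator simp: less_top[symmetric])
    also have "\<dots> = (\<integral>x. k x \<partial>M)"
      by (rule cond.real_cond_exp_int(2)[OF k_int])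
    also have "\<dots> \<le> (\<integral>x. f x \<partial>M)" by (rule integral_k_le)
    finally show ?thesis
      using c_pos unfolding emeasure_eq_measure
      by (intro ennreal_leI) (simp add: pos_le_divide_eq mult.commute)
  qed
  moreover have "emeasure M bad = (SUP n. emeasure M (?N n))"
  proof -
    have inc: "incseq ?N"
      by (rule incseq_SucI) (auto simp: alive_Suc[of "Suc _"])
    have "bad = (\<Union>n. ?N n)" by (auto simp: bad_def)
    also have "emeasure M \<dots> = (SUP n. emeasure M (?N n))"
      by (rule SUP_emeasure_incseq[symmetric, OF _ inc]) auto
    finally show ?thesis .
  qed
  ultimately show ?thesis by (simp add: SUP_least)
qed

end

text \<open>The form suits the subtraction of two decompositions: the exceptional sets
  \<open>N\<close> can be united, and the sign of \<open>k\<close> keeps the difference of two such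
  functions within \<open>lam\<close> in absolute value.\<close>

lemma nonneg_gundy_decomposition:
  fixes M :: "'a measure" and f :: "'a \<Rightarrow> real"
  assumes "prob_space M" and filt: "is_filtration M F"
    and f: "f \<in> borel_measurable (F_infinity M F)" "integrable M f" "\<And>x. 0 \<le> f x"
    and lam: "lam > 0"
  obtains g h k N where
    "g \<in> borel_measurable (F_infinity M F)" "h \<in> borel_measurable (F_infinity M F)"
    "k \<in> borel_measurable (F_infinity M F)"
    "integrable M g" "integrable M h" "integrable M k"
    "\<forall>x. f x = g x + h x + k x"
    "N \<in> sets M" "emeasure M N \<le> ennreal (2 * (\<integral>x. f x \<partial>M) / lam)"
    "AE x in M. x \<notin> N \<longrightarrow> (\<forall>n. cexp M F n g x = 0)"
    "(\<integral>\<^sup>+ x. ennreal \<bar>g x\<bar> \<partial>M) \<le> ennreal (2 * (\<integral>x. f x \<partial>M))"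
    "(\<integral>\<^sup>+ x. (\<Sum>n. ennreal \<bar>cexp M F (Suc n) h x - cexp M F n h x\<bar>) \<partial>M)
      \<le> ennreal (2 * (\<integral>x. f x \<partial>M))"
    "(\<integral>\<^sup>+ x. ennreal \<bar>h x\<bar> \<partial>M) \<le> ennreal (2 * (\<integral>x. f x \<partial>M))"
    "AE x in M. 0 \<le> k x \<and> k x \<le> lam" "(\<integral>x. k x \<partial>M) \<le> (\<integral>x. f x \<partial>M)"
proof -
  interpret prob_space M by fact
  interpret filtration "space M" "\<lambda>n. F (Suc n)"
    using filt by (simp add: is_filtration_def)
  \<comment> \<open>With \<open>c = lam / 2\<close> the bound \<open>2 * c\<close> on
    \<open>k\<close> becomes \<open>lam\<close>, and the bound on \<open>bad\<close> acquires its
    factor 2.\<close>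
  interpret nonneg_closed_martingale M "\<lambda>n. F (Suc n)" f "lam / 2"
    using filt f lam sets_F_mono by unfold_locales (auto simp: is_filtration_def)
  have "(\<Union>n\<in>{1..}. sets (F n)) = (\<Union>i. sets (F (Suc i)))"
  proof (intro equalityI subsetI)
    fix A assume "A \<in> (\<Union>n\<in>{1..}. sets (F n))"
    then obtain n where "n \<ge> 1" "A \<in> sets (F n)" by auto
    then show "A \<in> (\<Union>i. sets (F (Suc i)))" by (cases n) auto
  qed auto
  then have inf: "F_infinity M F = G_inf"
    by (simp add: F_infinity_def G_inf_def)
  note f_inf = f(1)[unfolded inf]
  have "AE x in M. \<forall>n. real_cond_exp M (F (Suc n)) h x = (\<Sum>i\<le>n. dh i x)"
    using cond_exp_h by (simp add: AE_all_countable)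
  \<comment> \<open>For \<open>n = 0\<close> the subtracted term is 0 by the definition of
    \<open>cexp\<close>, and the difference is the first conditional expectation, that is,
    \<open>dh 0\<close>.\<close>
  then have "AE x in M. \<forall>n. cexp M F (Suc n) h x - cexp M F n h x = dh n x"
  proof eventually_elim
    fix x assume eq: "\<forall>n. real_cond_exp M (F (Suc n)) h x = (\<Sum>i\<le>n. dh i x)"
    show "\<forall>n. cexp M F (Suc n) h x - cexp M F n h x = dh n x"
    proof
      show "cexp M F (Suc n) h x - cexp M F n h x = dh n x" for n
        by (cases n) (simp_all add: cexp_def eq)
    qed
  qed
  then have dh_eq: "(\<integral>\<^sup>+ x. (\<Sum>n. ennreal \<bar>cexp M F (Suc n) h x - cexp M F n h x\<bar>) \<partial>M)
      = (\<integral>\<^sup>+ x. (\<Sum>n. ennreal \<bar>dh n x\<bar>) \<partial>M)"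
    by (intro nn_integral_cong_AE) (auto elim!: eventually_mono)
  have g0: "AE x in M. x \<notin> bad \<longrightarrow> (\<forall>n. cexp M F n g x = 0)"
    using cond_exp_g_eq_0
  proof eventually_elim
    fix x assume *: "x \<notin> bad \<longrightarrow> (\<forall>n. real_cond_exp M (F (Suc n)) g x = 0)"
    have "cexp M F n g x = 0" if "x \<notin> bad" for n
      using * that by (cases n) (simp_all add: cexp_def)
    then show "x \<notin> bad \<longrightarrow> (\<forall>n. cexp M F n g x = 0)" by blast
  qed
  show ?thesis
    by (rule that[of g h k bad])
      (use f_inf g_meas_inf h_meas_inf k_meas_inf g_int h_int k_int bad_sets bad_le g0 nn_integral_g_le
        nn_integral_dh_le nn_integral_h_le k_bounds integral_k_le
       in \<open>simp_all add: inf dh_eq k_def mult.commute\<close>)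
qed

section \<open>The general case\<close>

lemma Lp_norm_1: "Lp_norm M 1 f = (\<integral>\<^sup>+ x. ennreal \<bar>f x\<bar> \<partial>M)"
  by (auto simp: Lp_norm_def Let_def less_top)

lemma Lp_norm_2_square: "(Lp_norm M 2 f)\<^sup>2 = (\<integral>\<^sup>+ x. ennreal ((f x)\<^sup>2) \<partial>M)"
proof -
  let ?I = "\<integral>\<^sup>+ x. ennreal ((f x)\<^sup>2) \<partial>M"
  have *: "Lp_norm M 2 f = (if ?I = \<infinity> then \<infinity> else ennreal (enn2real ?I powr (1 / 2)))"
    by (simp add: Lp_norm_def Let_def powr_numeral)
  show ?thesis
  proof (cases "?I = \<infinity>")
    case True
    then show ?thesis by (simp add: * power2_eq_square ennreal_mult_eq_top_iff)
  next
    case False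
    then have "(Lp_norm M 2 f)\<^sup>2 = ennreal ((enn2real ?I powr (1 / 2))\<^sup>2)"
      by (simp add: * ennreal_power)
    also have "(enn2real ?I powr (1 / 2))\<^sup>2 = enn2real ?I"
      by (simp add: powr_half_sqrt)
    finally show ?thesis using False by (simp add: less_top)
  qed
qed

text \<open>A single null set for all \<open>n\<close> allows sums and suprema over \<open>n\<close>
  to be compared pointwise.\<close>

lemma cexp_diff:
  assumes "prob_space M" "is_filtration M F" "integrable M u" "integrable M v"
  shows "AE x in M. \<forall>n. cexp M F n (\<lambda>x. u x - v x) x = cexp M F n u x - cexp M F n v x"
proof (subst AE_all_countable, intro allI)
  fix n
  interpret prob_space M by fact
  show "AE x in M. cexp M F n (\<lambda>x. u x - v x) x = cexp M F n u x - cexp M F n v x"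
  proof (cases "n = 0")
    case False
    then interpret finite_measure_subalgebra M "F n"
      using assms(2) by unfold_locales (simp add: is_filtration_def)
    show ?thesis using False assms(3,4) by (simp add: cexp_def)
  qed (simp add: cexp_def)
qed

lemma cexp_measurable [measurable]: "cexp M F n u \<in> borel_measurable M"
  by (simp add: cexp_def)

lemma nn_integral_abs_diff_le:
  fixes u v :: "'a \<Rightarrow> real"
  assumes [measurable]: "u \<in> borel_measurable M" "v \<in> borel_measurable M"
  shows "(\<integral>\<^sup>+ x. ennreal \<bar>u x - v x\<bar> \<partial>M) \<le> (\<integral>\<^sup>+ x. ennreal \<bar>u x\<bar> \<partial>M) + (\<integral>\<^sup>+ x. ennreal \<bar>v x\<bar> \<partial>M)"
proof -
  have "(\<integral>\<^sup>+ x. ennreal \<bar>u x - v x\<bar> \<partial>M) \<le> (\<integral>\<^sup>+ x. ennreal \<bar>u x\<bar> + ennreal \<bar>v x\<bar> \<partial>M)"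
    by (intro nn_integral_mono) (simp add: ennreal_plus[symmetric] abs_triangle_ineq4 del: ennreal_plus)
  then show ?thesis by (simp add: nn_integral_add)
qed

theorem corollary2p13:
  fixes M :: "'a measure" and F :: "nat \<Rightarrow> 'a measure"
    and f :: "'a \<Rightarrow> real" and lam :: real
  assumes "prob_space M" and "complete_measure M"
    and "is_filtration M F"
    and "f \<in> Lp_space M (F_infinity M F) 1"
    and "lam > 0"
  shows "\<exists>g h k.
      g \<in> Lp_space M (F_infinity M F) 1 \<and>
      h \<in> Lp_space M (F_infinity M F) 1 \<and>
      k \<in> Lp_space M (F_infinity M F) 1 \<and>
      (AE x in M. f x = g x + h x + k x) \<and>
      emeasure M {x \<in> space M. (SUP n\<in>{1..}. ennreal \<bar>cexp M F n g x\<bar>) > 0}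
        \<le> 2 * Lp_norm M 1 f / ennreal lam \<and>
      Lp_norm M 1 g \<le> 4 * Lp_norm M 1 f \<and>
      (\<integral>\<^sup>+ x. (\<Sum>n. ennreal \<bar>cexp M F (Suc n) h x - cexp M F n h x\<bar>) \<partial>M)
        \<le> 4 * Lp_norm M 1 f \<and>
      Lp_norm M 1 h \<le> 4 * Lp_norm M 1 f \<and>
      Linf_norm M k \<le> ennreal lam \<and>
      Lp_norm M 1 k \<le> 2 * Lp_norm M 1 f \<and>
      (Lp_norm M 2 k)\<^sup>2 \<le> 2 * ennreal lam * Lp_norm M 1 f"
proof -
  interpret prob_space M by fact
  note filt = assms(3)
  have "(\<Union>n\<in>{1..}. sets (F n)) \<subseteq> sets M"
    using filt by (auto simp: is_filtration_def subalgebra_def)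
  then have sub_inf: "subalgebra M (F_infinity M F)"
    unfolding subalgebra_def F_infinity_def
    using sets.space_closed[of M] by (auto simp: space_measure_of_conv sets.sigma_sets_subset)
  note to_M = measurable_from_subalg[OF sub_inf]
  have f_inf: "f \<in> borel_measurable (F_infinity M F)" and f_fin: "(\<integral>\<^sup>+ x. ennreal \<bar>f x\<bar> \<partial>M) < \<infinity>"
    using assms(4) by (auto simp: Lp_space_def Lp_norm_1)
  note [measurable] = to_M[OF f_inf]
  have f_int: "integrable M f"
    using f_fin by (intro integrableI_bounded) auto
  \<comment> \<open>The integrals \<open>p\<close> and \<open>q\<close> of the two parts add up to
    the norm of \<open>f\<close>, so bounds linear in them combine into bounds by that norm.\<close>
  define fp fm where "fp x = max (f x) 0" and "fm x = max (- f x) 0" for x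
  have fp: "fp \<in> borel_measurable (F_infinity M F)" "integrable M fp" "\<And>x. 0 \<le> fp x"
    unfolding fp_def[abs_def] using f_inf f_int by auto
  have fm: "fm \<in> borel_measurable (F_infinity M F)" "integrable M fm" "\<And>x. 0 \<le> fm x"
    unfolding fm_def[abs_def] using f_inf f_int by auto
  define p q where "p = (\<integral>x. fp x \<partial>M)" and "q = (\<integral>x. fm x \<partial>M)"
  have pq_nonneg: "0 \<le> p" "0 \<le> q"
    unfolding p_def q_def using fp(3) fm(3) by (simp_all add: integral_nonneg_AE)
  have f_norm: "Lp_norm M 1 f = ennreal (p + q)"
  proof -
    have "\<bar>f x\<bar> = fp x + fm x" for x by (simp add: fp_def fm_def)
    then have "Lp_norm M 1 f = (\<integral>\<^sup>+ x. ennreal (fp x + fm x) \<partial>M)"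
      by (simp only: Lp_norm_1)
    also have "\<dots> = ennreal (\<integral>x. fp x + fm x \<partial>M)"
      using fp fm by (intro nn_integral_eq_integral Bochner_Integration.integrable_add) auto
    also have "(\<integral>x. fp x + fm x \<partial>M) = p + q"
      unfolding p_def q_def by (intro Bochner_Integration.integral_add fp fm)
    finally show ?thesis .
  qed
  obtain g1 h1 k1 N1 where m1: "g1 \<in> borel_measurable (F_infinity M F)" "h1 \<in> borel_measurable (F_infinity M F)"
      "k1 \<in> borel_measurable (F_infinity M F)"
    and i1: "integrable M g1" "integrable M h1" "integrable M k1"
    and f1: "\<forall>x. fp x = g1 x + h1 x + k1 x"
    and N1: "N1 \<in> sets M" "emeasure M N1 \<le> ennreal (2 * p / lam)"
      "AE x in M. x \<notin> N1 \<longrightarrow> (\<forall>n. cexp M F n g1 x = 0)"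
    and g1: "(\<integral>\<^sup>+ x. ennreal \<bar>g1 x\<bar> \<partial>M) \<le> ennreal (2 * p)"
    and dh1: "(\<integral>\<^sup>+ x. (\<Sum>n. ennreal \<bar>cexp M F (Suc n) h1 x - cexp M F n h1 x\<bar>) \<partial>M) \<le> ennreal (2 * p)"
    and h1: "(\<integral>\<^sup>+ x. ennreal \<bar>h1 x\<bar> \<partial>M) \<le> ennreal (2 * p)"
    and k1: "AE x in M. 0 \<le> k1 x \<and> k1 x \<le> lam" "(\<integral>x. k1 x \<partial>M) \<le> p"
    by (rule nonneg_gundy_decomposition[OF assms(1) filt fp assms(5), folded p_def]) (rule that; assumption)
  obtain g2 h2 k2 N2 where m2: "g2 \<in> borel_measurable (F_infinity M F)" "h2 \<in> borel_measurable (F_infinity M F)"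
      "k2 \<in> borel_measurable (F_infinity M F)"
    and i2: "integrable M g2" "integrable M h2" "integrable M k2"
    and f2: "\<forall>x. fm x = g2 x + h2 x + k2 x"
    and N2: "N2 \<in> sets M" "emeasure M N2 \<le> ennreal (2 * q / lam)"
      "AE x in M. x \<notin> N2 \<longrightarrow> (\<forall>n. cexp M F n g2 x = 0)"
    and g2: "(\<integral>\<^sup>+ x. ennreal \<bar>g2 x\<bar> \<partial>M) \<le> ennreal (2 * q)"
    and dh2: "(\<integral>\<^sup>+ x. (\<Sum>n. ennreal \<bar>cexp M F (Suc n) h2 x - cexp M F n h2 x\<bar>) \<partial>M) \<le> ennreal (2 * q)"
    and h2: "(\<integral>\<^sup>+ x. ennreal \<bar>h2 x\<bar> \<partial>M) \<le> ennreal (2 * q)"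
    and k2: "AE x in M. 0 \<le> k2 x \<and> k2 x \<le> lam" "(\<integral>x. k2 x \<partial>M) \<le> q"
    by (rule nonneg_gundy_decomposition[OF assms(1) filt fm assms(5), folded q_def]) (rule that; assumption)
  note [measurable] = m1[THEN to_M] m2[THEN to_M]
  define g h k where "g x = g1 x - g2 x" and "h x = h1 x - h2 x" and "k x = k1 x - k2 x" for x
  \<comment> \<open>The two halves together cost only twice the norm of \<open>f\<close>; the
    constant 4 leaves room.\<close>
  have two_le_four: "ennreal (2 * p) + ennreal (2 * q) \<le> 4 * Lp_norm M 1 f"
  proof -
    have "ennreal (2 * p) + ennreal (2 * q) = ennreal (2 * p + 2 * q)"
      using pq_nonneg by simp
    also have "\<dots> \<le> ennreal (4 * (p + q))" using pq_nonneg by (intro ennreal_leI) simp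
    also have "\<dots> = 4 * ennreal (p + q)"
      using pq_nonneg ennreal_mult[of 4 "p + q"] by simp
    finally show ?thesis by (simp only: f_norm)
  qed
  have g_norm: "Lp_norm M 1 g \<le> 4 * Lp_norm M 1 f"
    unfolding Lp_norm_1[of M g] g_def
    by (rule order_trans[OF nn_integral_abs_diff_le order_trans[OF add_mono[OF g1 g2] two_le_four]]) auto
  have h_norm: "Lp_norm M 1 h \<le> 4 * Lp_norm M 1 f"
    unfolding Lp_norm_1[of M h] h_def
    by (rule order_trans[OF nn_integral_abs_diff_le order_trans[OF add_mono[OF h1 h2] two_le_four]]) auto
  \<comment> \<open>Both terms lie between 0 and \<open>lam\<close>, so subtraction does not double
    the bound.\<close>
  have k_abs: "AE x in M. \<bar>k x\<bar> \<le> lam"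
    using k1(1) k2(1) by eventually_elim (auto simp: k_def abs_le_iff)
  have k_norm: "Lp_norm M 1 k \<le> ennreal (p + q)"
  proof -
    have "(\<integral>\<^sup>+ x. ennreal \<bar>k x\<bar> \<partial>M) \<le> (\<integral>\<^sup>+ x. ennreal (k1 x + k2 x) \<partial>M)"
      using k1(1) k2(1)
      by (intro nn_integral_mono_AE, eventually_elim) (intro ennreal_leI, simp add: k_def abs_le_iff)
    also have "\<dots> = ennreal (\<integral>x. k1 x + k2 x \<partial>M)"
    proof (rule nn_integral_eq_integral)
      show "AE x in M. 0 \<le> k1 x + k2 x"
        using k1(1) k2(1) by eventually_elim simp
    qed (intro Bochner_Integration.integrable_add i1 i2)
    also have "\<dots> \<le> ennreal (p + q)"
      using i1 i2 k1(2) k2(2) by (intro ennreal_leI) simp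
    finally show ?thesis by (simp only: Lp_norm_1)
  qed
  have k_norm2: "Lp_norm M 1 k \<le> 2 * Lp_norm M 1 f"
    using k_norm by (simp add: f_norm mult_2 add_increasing)
  have k_sq: "(Lp_norm M 2 k)\<^sup>2 \<le> 2 * ennreal lam * Lp_norm M 1 f"
  proof -
    have "(Lp_norm M 2 k)\<^sup>2 \<le> (\<integral>\<^sup>+ x. ennreal lam * ennreal \<bar>k x\<bar> \<partial>M)"
      unfolding Lp_norm_2_square
      using k_abs
    proof (intro nn_integral_mono_AE, eventually_elim)
      fix x assume "\<bar>k x\<bar> \<le> lam"
      then have "(k x)\<^sup>2 \<le> lam * \<bar>k x\<bar>"
        using mult_right_mono[of "\<bar>k x\<bar>" lam "\<bar>k x\<bar>"] by (simp add: power2_eq_square)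
      then show "ennreal ((k x)\<^sup>2) \<le> ennreal lam * ennreal \<bar>k x\<bar>"
        using assms(5) by (simp add: ennreal_mult'[symmetric] ennreal_leI)
    qed
    also have "\<dots> = ennreal lam * Lp_norm M 1 k"
      unfolding Lp_norm_1 by (intro nn_integral_cmult) (simp add: k_def)
    also have "\<dots> \<le> ennreal lam * (2 * Lp_norm M 1 f)"
      by (intro mult_left_mono k_norm2) simp
    finally show ?thesis by (simp add: ac_simps)
  qed
  have h_var: "(\<integral>\<^sup>+ x. (\<Sum>n. ennreal \<bar>cexp M F (Suc n) h x - cexp M F n h x\<bar>) \<partial>M) \<le> 4 * Lp_norm M 1 f"
  proof -
    let ?d = "\<lambda>u x n. ennreal \<bar>cexp M F (Suc n) u x - cexp M F n u x\<bar>"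
    have "(\<integral>\<^sup>+ x. (\<Sum>n. ?d h x n) \<partial>M) \<le> (\<integral>\<^sup>+ x. (\<Sum>n. ?d h1 x n) + (\<Sum>n. ?d h2 x n) \<partial>M)"
      using cexp_diff[OF assms(1) filt i1(2) i2(2)]
    proof (intro nn_integral_mono_AE, eventually_elim)
      fix x assume "\<forall>n. cexp M F n (\<lambda>x. h1 x - h2 x) x = cexp M F n h1 x - cexp M F n h2 x"
      then have *: "cexp M F n h x = cexp M F n h1 x - cexp M F n h2 x" for n
        by (simp add: h_def[abs_def])
      have "?d h x n \<le> ?d h1 x n + ?d h2 x n" for n
        unfolding * by (simp add: ennreal_plus[symmetric] ennreal_leI del: ennreal_plus)
      then have "(\<Sum>n. ?d h x n) \<le> (\<Sum>n. ?d h1 x n + ?d h2 x n)"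
        by (intro suminf_le) auto
      also have "\<dots> = (\<Sum>n. ?d h1 x n) + (\<Sum>n. ?d h2 x n)"
        by (intro suminf_add[symmetric]) auto
      finally show "(\<Sum>n. ?d h x n) \<le> (\<Sum>n. ?d h1 x n) + (\<Sum>n. ?d h2 x n)" .
    qed
    also have "\<dots> = (\<integral>\<^sup>+ x. (\<Sum>n. ?d h1 x n) \<partial>M) + (\<integral>\<^sup>+ x. (\<Sum>n. ?d h2 x n) \<partial>M)"
      by (intro nn_integral_add) measurable
    also have "\<dots> \<le> 4 * Lp_norm M 1 f"
      by (rule order_trans[OF add_mono[OF dh1 dh2] two_le_four])
    finally show ?thesis .
  qed
  have g_supp: "emeasure M {x \<in> space M. (SUP n\<in>{1..}. ennreal \<bar>cexp M F n g x\<bar>) > 0}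
      \<le> 2 * Lp_norm M 1 f / ennreal lam"
  proof -
    \<comment> \<open>Almost everywhere outside \<open>N1 \<union> N2\<close>, all conditional
      expectations of both halves vanish, and with them the supremum.\<close>
    have "emeasure M {x \<in> space M. (SUP n\<in>{1..}. ennreal \<bar>cexp M F n g x\<bar>) > 0} \<le> emeasure M (N1 \<union> N2)"
    proof (rule emeasure_mono_AE)
      show "AE x in M. x \<in> {x \<in> space M. (SUP n\<in>{1..}. ennreal \<bar>cexp M F n g x\<bar>) > 0} \<longrightarrow> x \<in> N1 \<union> N2"
        using N1(3) N2(3) cexp_diff[OF assms(1) filt i1(1) i2(1)]
        by eventually_elim (auto simp: g_def[abs_def] less_SUP_iff)
    qed (rule sets.Un[OF N1(1) N2(1)])
    also have "\<dots> \<le> emeasure M N1 + emeasure M N2"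
      by (rule emeasure_subadditive[OF N1(1) N2(1)])
    also have "\<dots> \<le> ennreal (2 * p / lam) + ennreal (2 * q / lam)"
      by (intro add_mono N1 N2)
    also have "\<dots> = ennreal (2 * (p + q) / lam)"
      using pq_nonneg assms(5) by (simp add: add_divide_distrib distrib_left)
    also have "\<dots> = ennreal (2 * (p + q)) / ennreal lam"
      using pq_nonneg assms(5) by (intro divide_ennreal[symmetric]) auto
    also have "ennreal (2 * (p + q)) = 2 * ennreal (p + q)"
      using pq_nonneg ennreal_mult[of 2 "p + q"] by simp
    finally show ?thesis by (simp only: f_norm)
  qed
  have spaces: "g \<in> Lp_space M (F_infinity M F) 1" "h \<in> Lp_space M (F_infinity M F) 1" "k \<in> Lp_space M (F_infinity M F) 1"
  proof -
    have fin: "4 * Lp_norm M 1 f < \<infinity>" "2 * Lp_norm M 1 f < \<infinity>"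
      by (simp_all add: f_norm ennreal_mult_less_top)
    show "g \<in> Lp_space M (F_infinity M F) 1" "h \<in> Lp_space M (F_infinity M F) 1" "k \<in> Lp_space M (F_infinity M F) 1"
      using m1 m2 le_less_trans[OF g_norm fin(1)] le_less_trans[OF h_norm fin(1)] le_less_trans[OF k_norm2 fin(2)]
      by (auto simp: Lp_space_def g_def[abs_def] h_def[abs_def] k_def[abs_def])
  qed
  have "Linf_norm M k \<le> ennreal lam"
    unfolding Linf_norm_def using k_abs
    by (intro esssup_I) (auto simp: k_def[abs_def] elim!: eventually_mono intro: ennreal_leI)
  moreover have "f x = g x + h x + k x" for x
    using f1[rule_format, of x] f2[rule_format, of x] by (simp add: g_def h_def k_def fp_def fm_def max_def split: if_splits)
  ultimately show ?thesis
    using spaces g_supp g_norm h_var h_norm k_norm2 k_sq by blast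
qed

end
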